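(* Let $H$ be a Hopf algebra over an algebraically closed field $\mathbb{K}$ of characteristic zero which possesses a nonzero left integral $\int:H\to\mathbb{K}$. Define a bilinear product on the vector space $H$ by $$g*f:=\int\big(f\,S(g_1)\big)\cdot g_2,\qquad f,g\in H .$$ Then $(H,* )$ is an associative algebra (non-unital, i.e. no unit element is required).
   Context: $S$ is the antipode of $H$ and Sweedler's notation $\Delta(g)=g_1\otimes g_2$ (summation understood) is used for the coproduct. A left integral on $H$ is a nonzero linear functional $\int:H\to\mathbb{K}$ with $x_1\int(x_2)=\int(x)\,1_H$ for all $x\in H$; such a functional is fixed. *)

theory Defs
  imports Complex_Main "HOL-Library.Poly_Mapping" "HOL-Computational_Algebra.Polynomial"
begin

section \<open>Free vector spaces\<close>

text \<open>
  The free vector space over \<open>'k\<close> on the set of all elements of \<open>'i\<close> is the type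
  \<open>'i \<Rightarrow>\<^sub>0 'k\<close> of finitely supported functions, with basis \<open>basis_vec i\<close>.
\<close>

definition free_scale :: "'k::field \<Rightarrow> ('i \<Rightarrow>\<^sub>0 'k) \<Rightarrow> ('i \<Rightarrow>\<^sub>0 'k)" where
  "free_scale c t = Poly_Mapping.map ((*) c) t"

definition basis_vec :: "'i \<Rightarrow> ('i \<Rightarrow>\<^sub>0 'k::field)" where
  "basis_vec i = Poly_Mapping.single i 1"

text \<open>The linear extension of a map \<open>\<phi>\<close> from basis elements to a vector space with scalar
  multiplication \<open>sc\<close>.\<close>

definition free_lift ::
  "('k::field \<Rightarrow> 'v \<Rightarrow> 'v) \<Rightarrow> ('i \<Rightarrow> 'v) \<Rightarrow> ('i \<Rightarrow>\<^sub>0 'k) \<Rightarrow> 'v::ab_group_add" where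
  "free_lift sc \<phi> t = (\<Sum>i\<in>Poly_Mapping.keys t. sc (Poly_Mapping.lookup t i) (\<phi> i))"

lemma lookup_free_scale [simp]:
  "Poly_Mapping.lookup (free_scale c t) i = c * Poly_Mapping.lookup t i"
  by (simp add: free_scale_def Poly_Mapping.map.rep_eq when_def)

lemma vector_space_free_scale: "vector_space (free_scale :: 'k::field \<Rightarrow> ('i \<Rightarrow>\<^sub>0 'k) \<Rightarrow> _)"
  by unfold_locales (auto intro!: poly_mapping_eqI simp: lookup_add algebra_simps)


section \<open>The spaces \<open>H \<otimes> H\<close> and \<open>H \<otimes> H \<otimes> H\<close>\<close>

text \<open>
  Tensor products are constructed as quotients of free vector spaces: \<open>H \<otimes> H\<close> is the
  free vector space on \<open>H \<times> H\<close> modulo the subspace spanned by the bilinearity relations, and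
  \<open>H \<otimes> H \<otimes> H\<close> is the free vector space on \<open>H \<times> H \<times> H\<close> modulo the trilinearity relations.
  The latter is identified as usual with both \<open>(H \<otimes> H) \<otimes> H\<close> and \<open>H \<otimes> (H \<otimes> H)\<close>.
  Elements of the tensor products are cosets, that is, sets of formal sums.
\<close>

inductive_set tensor2_rels ::
  "('k::field \<Rightarrow> 'a::ab_group_add \<Rightarrow> 'a) \<Rightarrow> ('a \<times> 'a \<Rightarrow>\<^sub>0 'k) set"
  for scale where
  "basis_vec (x + x', y) - basis_vec (x, y) - basis_vec (x', y) \<in> tensor2_rels scale"
| "basis_vec (x, y + y') - basis_vec (x, y) - basis_vec (x, y') \<in> tensor2_rels scale"
| "basis_vec (scale c x, y) - free_scale c (basis_vec (x, y)) \<in> tensor2_rels scale"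
| "basis_vec (x, scale c y) - free_scale c (basis_vec (x, y)) \<in> tensor2_rels scale"

inductive_set tensor3_rels ::
  "('k::field \<Rightarrow> 'a::ab_group_add \<Rightarrow> 'a) \<Rightarrow> ('a \<times> 'a \<times> 'a \<Rightarrow>\<^sub>0 'k) set"
  for scale where
  "basis_vec (x + x', y, z) - basis_vec (x, y, z) - basis_vec (x', y, z) \<in> tensor3_rels scale"
| "basis_vec (x, y + y', z) - basis_vec (x, y, z) - basis_vec (x, y', z) \<in> tensor3_rels scale"
| "basis_vec (x, y, z + z') - basis_vec (x, y, z) - basis_vec (x, y, z') \<in> tensor3_rels scale"
| "basis_vec (scale c x, y, z) - free_scale c (basis_vec (x, y, z)) \<in> tensor3_rels scale"
| "basis_vec (x, scale c y, z) - free_scale c (basis_vec (x, y, z)) \<in> tensor3_rels scale"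
| "basis_vec (x, y, scale c z) - free_scale c (basis_vec (x, y, z)) \<in> tensor3_rels scale"

definition span_cong :: "('i \<Rightarrow>\<^sub>0 'k::field) set \<Rightarrow> (('i \<Rightarrow>\<^sub>0 'k) \<times> ('i \<Rightarrow>\<^sub>0 'k)) set" where
  "span_cong R = {(s, t). s - t \<in> module.span free_scale R}"

definition tensor2 :: "('k::field \<Rightarrow> 'a::ab_group_add \<Rightarrow> 'a) \<Rightarrow> ('a \<times> 'a \<Rightarrow>\<^sub>0 'k) set set" where
  "tensor2 scale = UNIV // span_cong (tensor2_rels scale)"

definition class2 ::
  "('k::field \<Rightarrow> 'a::ab_group_add \<Rightarrow> 'a) \<Rightarrow> ('a \<times> 'a \<Rightarrow>\<^sub>0 'k) \<Rightarrow> ('a \<times> 'a \<Rightarrow>\<^sub>0 'k) set" where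
  "class2 scale t = span_cong (tensor2_rels scale) `` {t}"

definition class3 ::
  "('k::field \<Rightarrow> 'a::ab_group_add \<Rightarrow> 'a) \<Rightarrow> ('a \<times> 'a \<times> 'a \<Rightarrow>\<^sub>0 'k) \<Rightarrow>
   ('a \<times> 'a \<times> 'a \<Rightarrow>\<^sub>0 'k) set" where
  "class3 scale t = span_cong (tensor3_rels scale) `` {t}"

text \<open>A formal sum \<open>\<Sum> c\<^sub>i (x\<^sub>i, y\<^sub>i)\<close> representing a given tensor. The choice is
  immaterial wherever \<open>rep\<close> is used below; cf. \<open>sweedler_eq\<close>.\<close>

definition rep :: "('i \<Rightarrow>\<^sub>0 'k::field) set \<Rightarrow> ('i \<Rightarrow>\<^sub>0 'k)" where
  "rep T = (SOME t. t \<in> T)"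

text \<open>The linear map out of \<open>H \<otimes> H\<close> induced by a bilinear map \<open>\<phi>\<close>. In Sweedler notation,
  \<open>sweedler sc \<phi> (\<Delta> x)\<close> is \<open>\<phi>(x\<^sub>1, x\<^sub>2)\<close>, summation understood.\<close>

definition sweedler ::
  "('k::field \<Rightarrow> 'v \<Rightarrow> 'v) \<Rightarrow> ('a \<Rightarrow> 'b \<Rightarrow> 'v::ab_group_add) \<Rightarrow> ('a \<times> 'b \<Rightarrow>\<^sub>0 'k) set \<Rightarrow> 'v" where
  "sweedler sc \<phi> T = free_lift sc (\<lambda>(x, y). \<phi> x y) (rep T)"

text \<open>On formal sums: the product \<open>(a \<otimes> b)(c \<otimes> d) = ac \<otimes> bd\<close>, and the maps
  \<open>\<Delta> \<otimes> id\<close> and \<open>id \<otimes> \<Delta>\<close>.\<close>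

definition tensor_mult ::
  "('a::ring_1 \<times> 'a \<Rightarrow>\<^sub>0 'k::field) \<Rightarrow> ('a \<times> 'a \<Rightarrow>\<^sub>0 'k) \<Rightarrow> ('a \<times> 'a \<Rightarrow>\<^sub>0 'k)" where
  "tensor_mult s t =
     free_lift free_scale (\<lambda>(a, b).
       free_lift free_scale (\<lambda>(c, d). basis_vec (a * c, b * d)) t) s"

definition comult_id ::
  "('a \<Rightarrow> ('a \<times> 'a \<Rightarrow>\<^sub>0 'k::field) set) \<Rightarrow> ('a \<times> 'a \<Rightarrow>\<^sub>0 'k) \<Rightarrow> ('a \<times> 'a \<times> 'a \<Rightarrow>\<^sub>0 'k)" where
  "comult_id \<Delta> t =
     free_lift free_scale (\<lambda>(x, y).
       free_lift free_scale (\<lambda>(a, b). basis_vec (a, b, y)) (rep (\<Delta> x))) t"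

definition id_comult ::
  "('a \<Rightarrow> ('a \<times> 'a \<Rightarrow>\<^sub>0 'k::field) set) \<Rightarrow> ('a \<times> 'a \<Rightarrow>\<^sub>0 'k) \<Rightarrow> ('a \<times> 'a \<times> 'a \<Rightarrow>\<^sub>0 'k)" where
  "id_comult \<Delta> t =
     free_lift free_scale (\<lambda>(x, y).
       free_lift free_scale (\<lambda>(a, b). basis_vec (x, a, b)) (rep (\<Delta> y))) t"


section \<open>Hopf algebras and left integrals\<close>

locale nonunital_algebra = vector_space scale
  for scale :: "'k::field \<Rightarrow> 'a::ab_group_add \<Rightarrow> 'a" +
  fixes mul :: "'a \<Rightarrow> 'a \<Rightarrow> 'a"
  assumes linear_left: "Vector_Spaces.linear scale scale (\<lambda>x. mul x y)"
    and linear_right: "Vector_Spaces.linear scale scale (mul x)"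
    and assoc: "mul (mul x y) z = mul x (mul y z)"

text \<open>
  The underlying unital ring of \<open>H\<close> is the type \<open>'h\<close>. The requirement \<open>0 \<noteq> 1\<close> of the class
  \<open>ring_1\<close> is no restriction: it follows from \<open>\<epsilon> 1 = 1\<close> and linearity of \<open>\<epsilon>\<close>.
\<close>

locale hopf_algebra = nonunital_algebra scale "(*)"
  for scale :: "'k::field \<Rightarrow> 'h::ring_1 \<Rightarrow> 'h" +
  fixes \<Delta> :: "'h \<Rightarrow> ('h \<times> 'h \<Rightarrow>\<^sub>0 'k) set"
    and \<epsilon> :: "'h \<Rightarrow> 'k"
    and S :: "'h \<Rightarrow> 'h"
  assumes comult_in: "\<Delta> x \<in> tensor2 scale"
    and comult_add: "\<Delta> (x + y) = class2 scale (rep (\<Delta> x) + rep (\<Delta> y))"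
    and comult_scale: "\<Delta> (scale c x) = class2 scale (free_scale c (rep (\<Delta> x)))"
    and coassoc: "class3 scale (comult_id \<Delta> (rep (\<Delta> x))) = class3 scale (id_comult \<Delta> (rep (\<Delta> x)))"
    and counit_linear: "Vector_Spaces.linear scale (*) \<epsilon>"
    and counit_left: "sweedler scale (\<lambda>x\<^sub>1 x\<^sub>2. scale (\<epsilon> x\<^sub>1) x\<^sub>2) (\<Delta> x) = x"
    and counit_right: "sweedler scale (\<lambda>x\<^sub>1 x\<^sub>2. scale (\<epsilon> x\<^sub>2) x\<^sub>1) (\<Delta> x) = x"
    and comult_mult: "\<Delta> (x * y) = class2 scale (tensor_mult (rep (\<Delta> x)) (rep (\<Delta> y)))"
    and comult_one: "\<Delta> 1 = class2 scale (basis_vec (1, 1))"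
    and counit_mult: "\<epsilon> (x * y) = \<epsilon> x * \<epsilon> y"
    and counit_one: "\<epsilon> 1 = 1"
    and antipode_linear: "Vector_Spaces.linear scale scale S"
    and antipode_left: "sweedler scale (\<lambda>x\<^sub>1 x\<^sub>2. S x\<^sub>1 * x\<^sub>2) (\<Delta> x) = scale (\<epsilon> x) 1"
    and antipode_right: "sweedler scale (\<lambda>x\<^sub>1 x\<^sub>2. x\<^sub>1 * S x\<^sub>2) (\<Delta> x) = scale (\<epsilon> x) 1"

definition left_integral ::
  "('k::field \<Rightarrow> 'h::ring_1 \<Rightarrow> 'h) \<Rightarrow> ('h \<Rightarrow> ('h \<times> 'h \<Rightarrow>\<^sub>0 'k) set) \<Rightarrow> ('h \<Rightarrow> 'k) \<Rightarrow> bool" where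
  "left_integral scale \<Delta> I \<longleftrightarrow>
     Vector_Spaces.linear scale (*) I \<and> (\<exists>x. I x \<noteq> 0) \<and>
     (\<forall>x. sweedler scale (\<lambda>x\<^sub>1 x\<^sub>2. scale (I x\<^sub>2) x\<^sub>1) (\<Delta> x) = scale (I x) 1)"

text \<open>The product \<open>g * f = \<integral>(f S(g\<^sub>1)) g\<^sub>2\<close>; the first argument is \<open>g\<close>, the second \<open>f\<close>.\<close>

definition integral_prod ::
  "('k::field \<Rightarrow> 'h::ring_1 \<Rightarrow> 'h) \<Rightarrow> ('h \<Rightarrow> ('h \<times> 'h \<Rightarrow>\<^sub>0 'k) set) \<Rightarrow> ('h \<Rightarrow> 'h) \<Rightarrow> ('h \<Rightarrow> 'k) \<Rightarrow>
   'h \<Rightarrow> 'h \<Rightarrow> 'h" where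
  "integral_prod scale \<Delta> S I g f = sweedler scale (\<lambda>g\<^sub>1 g\<^sub>2. scale (I (f * S g\<^sub>1)) g\<^sub>2) (\<Delta> g)"


section \<open>Independence of representatives\<close>

lemma free_lift_superset:
  assumes "vector_space sc" "finite A" "Poly_Mapping.keys t \<subseteq> A"
  shows "free_lift sc \<phi> t = (\<Sum>i\<in>A. sc (Poly_Mapping.lookup t i) (\<phi> i))"
proof -
  interpret vector_space sc by fact
  show ?thesis
    unfolding free_lift_def
    by (rule sum.mono_neutral_left) (use assms in \<open>auto simp: in_keys_iff\<close>)
qed

lemma free_lift_linear:
  assumes "vector_space sc"
  shows "Vector_Spaces.linear free_scale sc (free_lift sc \<phi>)"
proof -
  interpret vector_space sc by fact
  interpret F: vector_space "free_scale :: 'a \<Rightarrow> ('c \<Rightarrow>\<^sub>0 'a) \<Rightarrow> _" by (rule vector_space_free_scale)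
  have add: "free_lift sc \<phi> (s + t) = free_lift sc \<phi> s + free_lift sc \<phi> t" for s t
  proof -
    let ?A = "Poly_Mapping.keys s \<union> Poly_Mapping.keys t"
    have "finite ?A" "Poly_Mapping.keys (s + t) \<subseteq> ?A"
      using Poly_Mapping.keys_add[of s t] by auto
    then show ?thesis
      by (simp add: free_lift_superset[OF assms, of ?A] lookup_add scale_left_distrib sum.distrib)
  qed
  have scl: "free_lift sc \<phi> (free_scale c t) = sc c (free_lift sc \<phi> t)" for c t
  proof -
    have "Poly_Mapping.keys (free_scale c t) \<subseteq> Poly_Mapping.keys t"
      by (auto simp: in_keys_iff)
    then show ?thesis
      by (simp add: free_lift_superset[OF assms, of "Poly_Mapping.keys t"] scale_sum_right)
  qed
  show ?thesis
    by unfold_locales (simp_all add: add scl)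
qed

lemma free_lift_basis_vec:
  assumes "vector_space sc"
  shows "free_lift sc \<phi> (basis_vec i) = \<phi> i"
proof -
  interpret vector_space sc by fact
  show ?thesis by (simp add: free_lift_def basis_vec_def)
qed

lemma free_lift_cong_tensor2:
  assumes l: "\<And>y. Vector_Spaces.linear scale sc (\<lambda>x. \<phi> x y)"
    and r: "\<And>x. Vector_Spaces.linear scale sc (\<phi> x)"
    and st: "(s, t) \<in> span_cong (tensor2_rels scale)"
  shows "free_lift sc (\<lambda>(x, y). \<phi> x y) s = free_lift sc (\<lambda>(x, y). \<phi> x y) t"
proof -
  let ?L = "free_lift sc (\<lambda>(x, y). \<phi> x y)"
  have st': "s - t \<in> module.span free_scale (tensor2_rels scale)"
    using st by (simp add: span_cong_def)
  interpret vs: vector_space sc by (rule Vector_Spaces.linear.axioms(2)[OF r])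
  interpret F: Vector_Spaces.linear free_scale sc ?L
    by (rule free_lift_linear) unfold_locales
  note hl = Vector_Spaces.linear.axioms(3)[OF l]
  note hr = Vector_Spaces.linear.axioms(3)[OF r]
  note b = free_lift_basis_vec[OF vs.vector_space_axioms]
  have "?L u = 0" if "u \<in> tensor2_rels scale" for u
    using that
  proof (induction rule: tensor2_rels.induct)
    case (1 x x' y)
    show ?case by (simp only: F.diff b prod.case module_hom.add[OF hl]) simp
  next
    case (2 x y y')
    show ?case by (simp only: F.diff b prod.case module_hom.add[OF hr]) simp
  next
    case (3 c x y)
    show ?case by (simp only: F.diff F.scale b prod.case module_hom.scale[OF hl]) simp
  next
    case (4 x c y)
    show ?case by (simp only: F.diff F.scale b prod.case module_hom.scale[OF hr]) simp
  qed
  then have "?L (s - t) = 0"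
    by (rule F.eq_0_on_span[OF _ st'])
  then show ?thesis by (simp add: F.diff)
qed

lemma sweedler_eq:
  assumes "\<And>y. Vector_Spaces.linear scale sc (\<lambda>x. \<phi> x y)"
    and "\<And>x. Vector_Spaces.linear scale sc (\<phi> x)"
    and "T \<in> tensor2 scale" "t \<in> T"
  shows "sweedler sc \<phi> T = free_lift sc (\<lambda>(x, y). \<phi> x y) t"
proof -
  obtain u where u: "T = span_cong (tensor2_rels scale) `` {u}"
    using assms(3) by (auto simp: tensor2_def quotient_def)
  have "rep T \<in> T" unfolding rep_def using assms(4) by (rule someI)
  then have "(u, rep T) \<in> span_cong (tensor2_rels scale)" "(u, t) \<in> span_cong (tensor2_rels scale)"
    using assms(4) u by auto
  then show ?thesis
    unfolding sweedler_def
    by (rule trans[OF free_lift_cong_tensor2[OF assms(1,2), symmetric]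
          free_lift_cong_tensor2[OF assms(1,2)]])
qed

end

theory Submission
  imports Defs
begin

text \<open>
  The product has a second description, \<open>g * f = f\<^sub>1 \<integral>(f\<^sub>2 S(g))\<close>. To see this, apply the left
  integral property to \<open>x = f S(g\<^sub>1)\<close> and multiply by \<open>g\<^sub>2\<close> from the right; the claim then follows
  from the identity \<open>\<Delta>(S(g\<^sub>1)) (g\<^sub>2 \<otimes> 1) = 1 \<otimes> S(g)\<close>, which is obtained by inserting
  \<open>g\<^sub>3 S(g\<^sub>4)\<close> in the second factor and using \<open>\<Delta>(S(g\<^sub>1)) \<Delta>(g\<^sub>2) = \<epsilon>(g) 1 \<otimes> 1\<close>.
  In particular it is not necessary to know that \<open>S\<close> reverses the comultiplication.
  Substituting the second description of \<open>g\<^sub>1 * f\<close> gives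
  \<open>g * (f * h) = \<integral>(h S(f\<^sub>1)) \<integral>(f\<^sub>2 S(g\<^sub>1)) g\<^sub>2 = \<integral>(h S(g\<^sub>2)) \<integral>(f S(g\<^sub>1)) g\<^sub>3 = (g * f) * h\<close>.
\<close>

section \<open>Linear maps out of free vector spaces\<close>

lemma free_lift_free_lift:
  assumes "vector_space sc"
  shows "free_lift sc \<phi> (free_lift free_scale \<chi> t) = free_lift sc (\<lambda>i. free_lift sc \<phi> (\<chi> i)) t"
proof -
  interpret L: Vector_Spaces.linear free_scale sc "free_lift sc \<phi>"
    by (rule free_lift_linear[OF assms])
  show ?thesis
    unfolding free_lift_def[of free_scale]
    by (simp add: L.sum L.scale free_lift_def[of sc "\<lambda>i. free_lift sc \<phi> (\<chi> i)"])
qed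

lemma free_lift_image:
  assumes "Vector_Spaces.linear sc sc' L"
  shows "L (free_lift sc \<phi> t) = free_lift sc' (\<lambda>i. L (\<phi> i)) t"
proof -
  interpret L: Vector_Spaces.linear sc sc' L by fact
  show ?thesis by (simp add: free_lift_def L.sum L.scale)
qed

lemma free_lift_swap:
  assumes "vector_space sc"
  shows "free_lift sc (\<lambda>i. free_lift sc (\<lambda>j. \<phi> i j) t) s = free_lift sc (\<lambda>j. free_lift sc (\<lambda>i. \<phi> i j) s) t"
proof -
  interpret vector_space sc by fact
  show ?thesis
    unfolding free_lift_def scale_sum_right
    by (subst sum.swap) (simp add: mult.commute)
qed

lemma span_cong_refl: "(t :: 'i \<Rightarrow>\<^sub>0 'k::field, t) \<in> span_cong R"
proof -
  interpret F: vector_space "free_scale :: 'k \<Rightarrow> ('i \<Rightarrow>\<^sub>0 'k) \<Rightarrow> _" by (rule vector_space_free_scale)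
  show ?thesis by (simp add: span_cong_def F.span_zero)
qed

lemma mem_class2: "t \<in> class2 scale t"
  by (simp add: class2_def span_cong_refl)

lemma class3_eqD: "class3 scale s = class3 scale t \<Longrightarrow> (s, t) \<in> span_cong (tensor3_rels scale)"
  unfolding class3_def using span_cong_refl by fastforce

text \<open>A trilinear map sends each of the six kinds of relations to zero, so its linear
  extension descends to the threefold tensor product. This makes the axiom \<open>coassoc\<close>,
  an equality of cosets, usable for computation.\<close>

lemma free_lift_cong_tensor3:
  assumes l1: "\<And>y z. Vector_Spaces.linear scale sc (\<lambda>x. \<phi> x y z)"
    and l2: "\<And>x z. Vector_Spaces.linear scale sc (\<lambda>y. \<phi> x y z)"
    and l3: "\<And>x y. Vector_Spaces.linear scale sc (\<lambda>z. \<phi> x y z)"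
    and st: "(s, t) \<in> span_cong (tensor3_rels scale)"
  shows "free_lift sc (\<lambda>(x, y, z). \<phi> x y z) s = free_lift sc (\<lambda>(x, y, z). \<phi> x y z) t"
proof -
  let ?L = "free_lift sc (\<lambda>(x, y, z). \<phi> x y z)"
  have st': "s - t \<in> module.span free_scale (tensor3_rels scale)"
    using st by (simp add: span_cong_def)
  interpret vs: vector_space sc by (rule Vector_Spaces.linear.axioms(2)[OF l1])
  interpret F: Vector_Spaces.linear free_scale sc ?L
    by (rule free_lift_linear) unfold_locales
  note hom = l1[THEN Vector_Spaces.linear.axioms(3)] l2[THEN Vector_Spaces.linear.axioms(3)]
    l3[THEN Vector_Spaces.linear.axioms(3)]
  note b = free_lift_basis_vec[OF vs.vector_space_axioms]
  have "?L u = 0" if "u \<in> tensor3_rels scale" for u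
    using that
    by cases (simp_all only: F.diff F.scale b prod.case hom[THEN module_hom.add]
        hom[THEN module_hom.scale], simp_all)
  then have "?L (s - t) = 0"
    by (rule F.eq_0_on_span[OF _ st'])
  then show ?thesis by (simp add: F.diff)
qed

lemma vector_space_self: "vector_space ((*) :: 'k::field \<Rightarrow> 'k \<Rightarrow> 'k)"
  by unfold_locales (auto simp: algebra_simps)

lemma linear_iff_add_scale:
  assumes "vector_space sc" "vector_space sc'"
  shows "Vector_Spaces.linear sc sc' f \<longleftrightarrow>
    (\<forall>x y. f (x + y) = f x + f y) \<and> (\<forall>c x. f (sc c x) = sc' c (f x))"
  using assms
  by (auto simp: Vector_Spaces.linear_def module_hom_def module_hom_axioms_def
      module_def vector_space_def)


section \<open>Calculating with Sweedler notation\<close>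

definition bilin ::
  "('k::field \<Rightarrow> 'a::ab_group_add \<Rightarrow> 'a) \<Rightarrow> ('k \<Rightarrow> 'v::ab_group_add \<Rightarrow> 'v) \<Rightarrow> ('a \<Rightarrow> 'a \<Rightarrow> 'v) \<Rightarrow> bool" where
  "bilin scale sc \<phi> \<longleftrightarrow>
     (\<forall>y. Vector_Spaces.linear scale sc (\<lambda>x. \<phi> x y)) \<and> (\<forall>x. Vector_Spaces.linear scale sc (\<phi> x))"

lemma bilinI [intro?]:
  assumes "\<And>y. Vector_Spaces.linear scale sc (\<lambda>x. \<phi> x y)"
    and "\<And>x. Vector_Spaces.linear scale sc (\<lambda>y. \<phi> x y)"
  shows "bilin scale sc (\<lambda>x y. \<phi> x y)"
  using assms by (simp add: bilin_def)

context hopf_algebra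
begin

abbreviation sw :: "('k \<Rightarrow> 'v \<Rightarrow> 'v) \<Rightarrow> ('h \<Rightarrow> 'h \<Rightarrow> 'v::ab_group_add) \<Rightarrow> 'h \<Rightarrow> 'v" where
  "sw sc \<phi> x \<equiv> sweedler sc \<phi> (\<Delta> x)"

lemma sw_eq: "bilin scale sc \<phi> \<Longrightarrow> t \<in> \<Delta> x \<Longrightarrow> sw sc \<phi> x = free_lift sc (\<lambda>(x, y). \<phi> x y) t"
  by (rule sweedler_eq) (auto simp: bilin_def comult_in)

lemma vector_space_codomain: "bilin scale sc \<phi> \<Longrightarrow> vector_space sc"
  unfolding bilin_def by (blast dest: Vector_Spaces.linear.axioms(2))

text \<open>Bilinearity gives independence of the representative, so \<open>\<Delta> (x + y)\<close>
  may be evaluated at the sum of the representatives chosen for \<open>\<Delta> x\<close> and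
  \<open>\<Delta> y\<close>; scalars are treated likewise.\<close>

lemma linear_sw:
  assumes "bilin scale sc \<phi>"
  shows "Vector_Spaces.linear scale sc (sw sc \<phi>)"
proof -
  note vs = vector_space_codomain[OF assms]
  interpret L: Vector_Spaces.linear free_scale sc "free_lift sc (\<lambda>(x, y). \<phi> x y)"
    by (rule free_lift_linear[OF vs])
  have "sw sc \<phi> (x + y) = sw sc \<phi> x + sw sc \<phi> y" for x y
    by (subst sw_eq[OF assms, of "rep (\<Delta> x) + rep (\<Delta> y)"])
      (simp_all add: comult_add mem_class2 L.add sweedler_def)
  moreover have "sw sc \<phi> (scale c x) = sc c (sw sc \<phi> x)" for c x
    by (subst sw_eq[OF assms, of "free_scale c (rep (\<Delta> x))"])
      (simp_all add: comult_scale mem_class2 L.scale sweedler_def)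
  ultimately show ?thesis
    by (simp add: linear_iff_add_scale[OF vector_space_axioms vs])
qed

text \<open>Both sides are finite sums over the same representative \<open>rep (\<Delta> x)\<close>,
  so \<open>L\<close> simply passes through the sum.\<close>

lemma sw_image:
  "Vector_Spaces.linear sc sc' L \<Longrightarrow> L (sw sc \<phi> x) = sw sc' (\<lambda>a b. L (\<phi> a b)) x"
  by (simp add: sweedler_def free_lift_image case_prod_unfold)

lemma sw_swap:
  "vector_space sc \<Longrightarrow>
    sw sc (\<lambda>a b. sw sc (\<lambda>c d. \<phi> a b c d) y) x = sw sc (\<lambda>c d. sw sc (\<lambda>a b. \<phi> a b c d) x) y"
  by (simp add: sweedler_def case_prod_unfold free_lift_swap[of sc _ "rep (\<Delta> y)"])

text \<open>Evaluating one trilinear map on \<open>comult_id\<close> and on \<open>id_comult\<close>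
  produces the two nested Sweedler sums, and the two formal sums lie in one class.\<close>

lemma sw_coassoc:
  assumes "\<And>y z. Vector_Spaces.linear scale sc (\<lambda>x. \<phi> x y z)"
    and "\<And>x z. Vector_Spaces.linear scale sc (\<lambda>y. \<phi> x y z)"
    and "\<And>x y. Vector_Spaces.linear scale sc (\<lambda>z. \<phi> x y z)"
  shows "sw sc (\<lambda>a z. sw sc (\<lambda>x y. \<phi> x y z) a) g = sw sc (\<lambda>x b. sw sc (\<lambda>y z. \<phi> x y z) b) g"
proof -
  have vs: "vector_space sc" by (rule Vector_Spaces.linear.axioms(2)[OF assms(1)])
  have "free_lift sc (\<lambda>(x, y, z). \<phi> x y z) (comult_id \<Delta> (rep (\<Delta> g)))
      = free_lift sc (\<lambda>(x, y, z). \<phi> x y z) (id_comult \<Delta> (rep (\<Delta> g)))"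
    by (rule free_lift_cong_tensor3[OF assms class3_eqD[OF coassoc]])
  then show ?thesis
    by (simp add: comult_id_def id_comult_def sweedler_def free_lift_free_lift[OF vs]
        free_lift_basis_vec[OF vs] case_prod_unfold)
qed

lemma sw_mult:
  assumes "bilin scale sc \<phi>"
  shows "sw sc \<phi> (x * y) = sw sc (\<lambda>a b. sw sc (\<lambda>c d. \<phi> (a * c) (b * d)) y) x"
proof -
  note vs = vector_space_codomain[OF assms]
  show ?thesis
    by (subst sw_eq[OF assms, of "tensor_mult (rep (\<Delta> x)) (rep (\<Delta> y))"])
      (simp_all add: comult_mult mem_class2 tensor_mult_def sweedler_def free_lift_free_lift[OF vs]
        free_lift_basis_vec[OF vs] case_prod_unfold)
qed

lemma sw_one: "bilin scale sc \<phi> \<Longrightarrow> sw sc \<phi> 1 = \<phi> 1 1"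
  by (subst sw_eq[of _ _ "basis_vec (1, 1)"])
    (auto simp: comult_one mem_class2 free_lift_basis_vec dest: vector_space_codomain)

section \<open>Closure rules for linearity\<close>

lemma linear_compose':
  assumes "Vector_Spaces.linear sc' sc'' L" "Vector_Spaces.linear sc sc' f"
  shows "Vector_Spaces.linear sc sc'' (\<lambda>x. L (f x))"
  using Vector_Spaces.linear_compose[OF assms(2,1)] by (simp add: o_def)

lemma linear_sw_apply:
  assumes "bilin scale sc \<phi>" "Vector_Spaces.linear sc' scale f"
  shows "Vector_Spaces.linear sc' sc (\<lambda>x. sw sc \<phi> (f x))"
  by (rule linear_compose'[OF linear_sw]) fact+

text \<open>Here the variable sits in the summand and the coproduct is fixed, so the sum is a fixed
  linear combination of linear maps. In \<open>linear_sw_apply\<close> the variable sits under the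
  coproduct instead, which calls for bilinearity.\<close>

lemma linear_sw_param:
  assumes "\<And>a b. Vector_Spaces.linear sc' sc (\<lambda>x. \<phi> x a b)"
  shows "Vector_Spaces.linear sc' sc (\<lambda>x. sw sc (\<lambda>a b. \<phi> x a b) y)"
proof -
  have vs: "vector_space sc'" "vector_space sc"
    using Vector_Spaces.linear.axioms[OF assms] by auto
  interpret V: vector_space sc by fact
  show ?thesis
    using assms unfolding linear_iff_add_scale[OF vs]
    by (simp add: sweedler_def free_lift_def case_prod_unfold V.scale_right_distrib sum.distrib
        V.scale_sum_right mult.commute)
qed

lemma linear_id': "Vector_Spaces.linear scale scale (\<lambda>x. x)"
  by (simp add: linear_iff_add_scale vector_space_axioms)

lemmas linear_mult_left = linear_compose'[OF linear_left]
lemmas linear_mult_right = linear_compose'[OF linear_right]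
lemmas linear_S = linear_compose'[OF antipode_linear]

lemma linear_scale_form:
  assumes "vector_space sc" "Vector_Spaces.linear sc' (*) L"
  shows "Vector_Spaces.linear sc' sc (\<lambda>x. sc (L x) v)"
proof -
  interpret V: vector_space sc by fact
  have "Vector_Spaces.linear (*) sc (\<lambda>c. sc c v)"
    by (subst linear_iff_add_scale)
      (unfold_locales, auto simp: algebra_simps V.scale_left_distrib)
  from linear_compose'[OF this assms(2)] show ?thesis .
qed

lemma linear_scale_right':
  assumes "Vector_Spaces.linear sc' sc f"
  shows "Vector_Spaces.linear sc' sc (\<lambda>x. sc c (f x))"
proof -
  have vs: "vector_space sc'" "vector_space sc"
    using Vector_Spaces.linear.axioms[OF assms] by auto
  interpret V: vector_space sc by fact
  show ?thesis
    using assms unfolding linear_iff_add_scale[OF vs]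
    by (simp add: V.scale_right_distrib mult.commute)
qed

lemmas linear_intros = bilinI linear_id' linear_mult_left linear_mult_right linear_S
  linear_scale_right' linear_compose'[OF counit_linear]
  linear_scale_form[OF vector_space_axioms] linear_sw_apply linear_sw_param

section \<open>The antipode identity\<close>

text \<open>This is the identity \<open>\<Delta>(S(g\<^sub>1)) (g\<^sub>2 \<otimes> 1) = 1 \<otimes> S(g)\<close>, tested on a bilinear map.\<close>

lemma comult_antipode_mult:
  assumes \<phi>: "bilin scale sc \<phi>"
  shows "sw sc (\<lambda>g\<^sub>1 g\<^sub>2. sw sc (\<lambda>a b. \<phi> (a * g\<^sub>2) b) (S g\<^sub>1)) g = \<phi> 1 (S g)"
proof -
  note vs = vector_space_codomain[OF \<phi>]
  have l: "Vector_Spaces.linear scale sc (\<lambda>x. \<phi> x y)"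
    and r: "Vector_Spaces.linear scale sc (\<lambda>y. \<phi> x y)" for x y
    using \<phi> by (auto simp: bilin_def)
  note lin = linear_intros linear_compose'[OF l] linear_compose'[OF r]
  have scaleD: "L (scale c x) = sc c (L x)" if "Vector_Spaces.linear scale sc L" for L c x
    using that by (simp add: linear_iff_add_scale[OF vector_space_axioms vs])
  \<comment> \<open>The chain runs from the right-hand side to the left, starting with the expansion
    of \<open>g\<close> by the counit.\<close>
  have "\<phi> 1 (S g) = \<phi> 1 (S (sw scale (\<lambda>x\<^sub>1 x\<^sub>2. scale (\<epsilon> x\<^sub>1) x\<^sub>2) g))"
    by (simp add: counit_left)
  also have "\<dots> = sw sc (\<lambda>x w. \<phi> 1 (S (scale (\<epsilon> x) w))) g"
    by (rule sw_image) (intro lin)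
  \<comment> \<open>The factor \<open>1 *\<close> is inserted so that the next line can read the
    term as a sum over the coproduct of \<open>scale (\<epsilon> x) 1\<close>, which
    \<open>antipode_left\<close> then turns into a product.\<close>
  also have "\<dots> = sw sc (\<lambda>x w. sc (\<epsilon> x) (\<phi> 1 (1 * S w))) g"
    by (subst scaleD) (intro lin, simp)
  also have "\<dots> = sw sc (\<lambda>x w. sw sc (\<lambda>a b. \<phi> a (b * S w)) (scale (\<epsilon> x) 1)) g"
    by (subst scaleD, intro lin, subst sw_one, intro lin) (rule refl)
  also have "\<dots> = sw sc (\<lambda>v w. sw sc (\<lambda>a b. \<phi> a (b * S w)) (sw scale (\<lambda>x y. S x * y) v)) g"
    by (simp only: antipode_left)
  also have "\<dots> = sw sc (\<lambda>v w. sw sc (\<lambda>x y. sw sc (\<lambda>a b. \<phi> a (b * S w)) (S x * y)) v) g"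
    by (subst sw_image[OF linear_sw], intro lin) (rule refl)
  also have "\<dots> = sw sc (\<lambda>x u. sw sc (\<lambda>y w. sw sc (\<lambda>a b. \<phi> a (b * S w)) (S x * y)) u) g"
    by (rule sw_coassoc) (intro lin)+
  also have "\<dots> = sw sc (\<lambda>x u. sw sc (\<lambda>y w.
      sw sc (\<lambda>a b. sw sc (\<lambda>c d. \<phi> (a * c) (b * d * S w)) y) (S x)) u) g"
    by (subst sw_mult, intro lin) (rule refl)
  \<comment> \<open>Moving the sum over \<open>\<Delta> (S x)\<close> outwards leaves the splittings
    of \<open>u\<close> and \<open>y\<close> adjacent, ready for coassociativity to bring
    \<open>d\<close> and \<open>S w\<close> together.\<close>
  also have "\<dots> = sw sc (\<lambda>x u. sw sc (\<lambda>a b.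
      sw sc (\<lambda>y w. sw sc (\<lambda>c d. \<phi> (a * c) (b * d * S w)) y) u) (S x)) g"
    by (subst sw_swap[OF vs]) (rule refl)
  also have "\<dots> = sw sc (\<lambda>x u. sw sc (\<lambda>a b.
      sw sc (\<lambda>c v. sw sc (\<lambda>d w. \<phi> (a * c) (b * d * S w)) v) u) (S x)) g"
    by (subst sw_coassoc, (intro lin)+) (rule refl)
  also have "\<dots> = sw sc (\<lambda>x u. sw sc (\<lambda>a b.
      sw sc (\<lambda>c v. \<phi> (a * c) (b * sw scale (\<lambda>d w. d * S w) v)) u) (S x)) g"
  proof -
    have "\<phi> a (b * sw scale (\<lambda>d w. d * S w) v) = sw sc (\<lambda>d w. \<phi> a (b * d * S w)) v" for a b v
      by (subst sw_image[where sc' = sc and L = "\<lambda>t. \<phi> a (b * t)"], intro lin) (simp only: mult.assoc)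
    then show ?thesis by (simp only:)
  qed
  \<comment> \<open>After \<open>d * S w\<close> has collapsed to a scalar, that scalar moves from
    the second argument of \<open>\<phi>\<close> to the first, where the counit axiom reassembles
    \<open>u\<close>.\<close>
  also have "\<dots> = sw sc (\<lambda>x u. sw sc (\<lambda>a b.
      sw sc (\<lambda>c v. \<phi> (a * scale (\<epsilon> v) c) b) u) (S x)) g"
  proof -
    have "\<phi> (a * c) (b * scale k 1) = \<phi> (a * scale k c) b" for a b c k
      by (subst scaleD[of "\<lambda>t. \<phi> (a * c) (b * t)"], intro lin)
        (subst scaleD[of "\<lambda>t. \<phi> (a * t) b"], intro lin, simp)
    then show ?thesis by (simp only: antipode_right)
  qed
  also have "\<dots> = sw sc (\<lambda>x u. sw sc (\<lambda>a b. \<phi> (a * sw scale (\<lambda>c v. scale (\<epsilon> v) c) u) b) (S x)) g"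
  proof -
    have "\<phi> (a * sw scale (\<lambda>c v. scale (\<epsilon> v) c) u) b = sw sc (\<lambda>c v. \<phi> (a * scale (\<epsilon> v) c) b) u" for a b u
      by (rule sw_image[where L = "\<lambda>t. \<phi> (a * t) b"]) (intro lin)
    then show ?thesis by (simp only:)
  qed
  finally show ?thesis by (simp only: counit_right)
qed

section \<open>The two descriptions of the product, and associativity\<close>

lemma integral_prod_alt:
  assumes I: "left_integral scale \<Delta> I"
  shows "integral_prod scale \<Delta> S I g f = sw scale (\<lambda>f\<^sub>1 f\<^sub>2. scale (I (f\<^sub>2 * S g)) f\<^sub>1) f"
proof -
  have linI: "Vector_Spaces.linear scale (*) I"
    and int: "scale (I x) 1 = sw scale (\<lambda>x\<^sub>1 x\<^sub>2. scale (I x\<^sub>2) x\<^sub>1) x" for x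
    using I by (auto simp: left_integral_def)
  note lin = linear_intros linear_compose'[OF linI]
  have mult_scale: "scale c x * y = scale c (x * y)" for c x y
    using linear_left by (simp add: linear_iff_add_scale vector_space_axioms)
  have "integral_prod scale \<Delta> S I g f = sw scale (\<lambda>g\<^sub>1 g\<^sub>2. scale (I (f * S g\<^sub>1)) 1 * g\<^sub>2) g"
    by (simp add: integral_prod_def mult_scale)
  also have "\<dots> = sw scale (\<lambda>g\<^sub>1 g\<^sub>2. sw scale (\<lambda>a b. scale (I b) (a * g\<^sub>2)) (f * S g\<^sub>1)) g"
  proof -
    have "scale (I x) 1 * y = sw scale (\<lambda>a b. scale (I b) (a * y)) x" for x y
      unfolding int by (subst sw_image[OF linear_left]) (simp only: mult_scale)
    then show ?thesis by simp
  qed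
  \<comment> \<open>With the sum over \<open>f\<close> innermost, the summand is a bilinear map of
    \<open>a * g\<^sub>2\<close> and \<open>b\<close>, the shape required by
    \<open>comult_antipode_mult\<close>.\<close>
  also have "\<dots> = sw scale (\<lambda>g\<^sub>1 g\<^sub>2. sw scale (\<lambda>a b.
      sw scale (\<lambda>f\<^sub>1 f\<^sub>2. scale (I (f\<^sub>2 * b)) (f\<^sub>1 * (a * g\<^sub>2))) f) (S g\<^sub>1)) g"
    by (subst sw_mult, intro lin, subst sw_swap[OF vector_space_axioms]) (simp only: mult.assoc)
  also have "\<dots> = sw scale (\<lambda>f\<^sub>1 f\<^sub>2. scale (I (f\<^sub>2 * S g)) (f\<^sub>1 * 1)) f"
    by (rule comult_antipode_mult) (intro lin)
  finally show ?thesis by simp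
qed

lemma nonunital_algebra_integral_prod:
  assumes I: "left_integral scale \<Delta> I"
  shows "nonunital_algebra scale (integral_prod scale \<Delta> S I)"
proof (intro nonunital_algebra.intro nonunital_algebra_axioms.intro vector_space_axioms)
  have linI: "Vector_Spaces.linear scale (*) I"
    using I by (auto simp: left_integral_def)
  note lin = linear_intros linear_compose'[OF linI]
  let ?m = "integral_prod scale \<Delta> S I"
  show linl: "Vector_Spaces.linear scale scale (\<lambda>x. ?m x y)" for y
    unfolding integral_prod_def by (intro lin)
  show "Vector_Spaces.linear scale scale (?m x)" for x
    unfolding integral_prod_def by (intro lin)
  show "?m (?m g f) h = ?m g (?m f h)" for g f h
  proof -
    have linK: "Vector_Spaces.linear scale scale (\<lambda>t. scale (I (h * S t)) y)" for y
      by (intro lin)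
    have linJ: "Vector_Spaces.linear scale (*) (\<lambda>t. I (h * S t))"
      by (intro lin)
    have mulK: "I (h * S (scale c x)) = c * I (h * S x)" for c x
      using linJ by (simp add: linear_iff_add_scale vector_space_axioms vector_space_self)
    have mulI: "I (scale c x * y) = c * I (x * y)" for c x y
      using linI linear_left by (simp add: linear_iff_add_scale vector_space_axioms vector_space_self)
    have "?m g (?m f h) = sw scale (\<lambda>g\<^sub>1 g\<^sub>2. scale (I (?m f h * S g\<^sub>1)) g\<^sub>2) g"
      by (simp only: integral_prod_def)
    also have "\<dots> = sw scale (\<lambda>g\<^sub>1 g\<^sub>2. scale (I (h * S (?m g\<^sub>1 f))) g\<^sub>2) g"
    proof -
      \<comment> \<open>An adjointness relation: expanding the left product by its definition and
        the right one by \<open>integral_prod_alt\<close> gives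
        \<open>I (h * S f\<^sub>1) * I (f\<^sub>2 * S x)\<close> on both sides.\<close>
      have "I (?m f h * S x) = I (h * S (?m x f))" for x
      proof -
        have "I (?m f h * S x) = sw (*) (\<lambda>f\<^sub>1 f\<^sub>2. I (scale (I (h * S f\<^sub>1)) f\<^sub>2 * S x)) f"
          unfolding integral_prod_def
          by (rule sw_image[where L = "\<lambda>t. I (t * S x)"]) (intro lin)
        also have "\<dots> = sw (*) (\<lambda>f\<^sub>1 f\<^sub>2. I (h * S (scale (I (f\<^sub>2 * S x)) f\<^sub>1))) f"
          by (simp add: mulK mulI mult.commute)
        also have "\<dots> = I (h * S (?m x f))"
          unfolding integral_prod_alt[OF I]
          by (rule sw_image[where L = "\<lambda>t. I (h * S t)", symmetric]) (rule linJ)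
        finally show ?thesis .
      qed
      then show ?thesis by simp
    qed
    \<comment> \<open>This time the inner product is expanded by its original definition, so that
      only \<open>g\<close> is split and coassociativity applies.\<close>
    also have "\<dots> = sw scale (\<lambda>x z. sw scale (\<lambda>g\<^sub>1 g\<^sub>2. scale (I (h * S (scale (I (f * S g\<^sub>1)) g\<^sub>2))) z) x) g"
      unfolding integral_prod_def by (subst sw_image[OF linK]) (rule refl)
    also have "\<dots> = sw scale (\<lambda>g\<^sub>1 x. sw scale (\<lambda>g\<^sub>2 z. scale (I (h * S (scale (I (f * S g\<^sub>1)) g\<^sub>2))) z) x) g"
      by (rule sw_coassoc) (intro lin)+
    also have "\<dots> = sw scale (\<lambda>g\<^sub>1 x. scale (I (f * S g\<^sub>1)) (?m x h)) g"
    proof -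
      have "scale c (?m x h) = sw scale (\<lambda>g\<^sub>2 z. scale (I (h * S (scale c g\<^sub>2))) z) x" for c x
        unfolding integral_prod_def
        by (subst sw_image[where sc' = scale and L = "scale c"], intro lin) (simp add: mulK)
      then show ?thesis by (simp only:)
    qed
    \<comment> \<open>The scalar enters the first argument of the product, so that linearity there
      can collect the sum into \<open>?m g f\<close>.\<close>
    also have "\<dots> = sw scale (\<lambda>g\<^sub>1 x. ?m (scale (I (f * S g\<^sub>1)) x) h) g"
      using linl by (simp add: linear_iff_add_scale vector_space_axioms vector_space_self)
    also have "\<dots> = ?m (?m g f) h"
      unfolding integral_prod_def[where g = g]
      by (rule sw_image[where L = "\<lambda>t. ?m t h", symmetric]) (rule linl)
    finally show ?thesis by simp
  qed
qed

end

theorem lemma2p2: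
  fixes scale :: "'k::{alg_closed_field, field_char_0} \<Rightarrow> 'h::ring_1 \<Rightarrow> 'h"
    and \<Delta> :: "'h \<Rightarrow> ('h \<times> 'h \<Rightarrow>\<^sub>0 'k) set"
    and \<epsilon> :: "'h \<Rightarrow> 'k"
    and S :: "'h \<Rightarrow> 'h"
    and I :: "'h \<Rightarrow> 'k"
  assumes "hopf_algebra scale \<Delta> \<epsilon> S"
    and "left_integral scale \<Delta> I"
  shows "nonunital_algebra scale (integral_prod scale \<Delta> S I)"
  using assms by (rule hopf_algebra.nonunital_algebra_integral_prod)

end
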